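(* Let $(\mathbf x^*,\mathbf y^* )$ be an optimal solution of (m-RAOC-LP). For each $j\in\mathcal M$ let $(i_{1j},\dots,i_{nj})$ be a permutation of $\{1,\dots,n\}$ with $x^*_{i_{1j}j}\ge x^*_{i_{2j}j}\ge\dots\ge x^*_{i_{nj}j}$, let $S_{\ell j}=\{i_{1j},\dots,i_{\ell j}\}$ for $\ell\in\{1,\dots,n\}$, use the convention $x^*_{i_{n+1,j}j}=0$, and define $$q_j^*(S)=\begin{cases}\left(1+\sum_{s=1}^{\ell}v_{i_{sj}j}\right)\left(x^*_{i_{\ell j}j}-x^*_{i_{\ell+1,j}j}\right),&\text{if }S=S_{\ell j}\text{ for some }\ell\in\{1,\dots,n\},\\ 1-\sum_{\ell=1}^nq_j^*(S_{\ell j}),&\text{if }S=\varnothing,\\0,&\text{otherwise.}\end{cases}$$ Then $\{q_j^*(\cdot)\}_{j\in\mathcal M}$ is an optimal solution of (m-RAOC).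
   Context: Products $\mathcal N=\{1,\dots,n\}$ have revenues $r_i\in\mathbb R$. Customer segments $\mathcal M=\{1,\dots,m\}$ have arrival probabilities $\theta_j\ge0$, $\sum_j\theta_j=1$, and preference weights $v_{ij}>0$ ($i\in\mathcal N$, $j\in\mathcal M$). There are categories $C_1,\dots,C_K\subseteq\mathcal N$ (possibly overlapping) with thresholds $0\le\ell_k\le|C_k|$. Let $R_j(S)=\dfrac{\sum_{i\in S}r_iv_{ij}}{1+\sum_{i\in S}v_{ij}}$. (m-RAOC): maximize $\sum_{j\in\mathcal M}\sum_{S\subseteq\mathcal N}\theta_jR_j(S)q_j(S)$ over functions $q_j:2^{\mathcal N}\to\mathbb R$ ($j\in\mathcal M$) subject to $\sum_{j\in\mathcal M}\sum_{S\subseteq\mathcal N}\theta_j|S\cap C_k|q_j(S)\ge\ell_k$ for all $k\in\{1,\dots,K\}$, $\sum_{S\subseteq\mathcal N}q_j(S)=1$ for all $j\in\mathcal M$, and $q_j(S)\ge0$ for all $S\subseteq\mathcal N$, $j\in\mathcal M$. (m-RAOC-LP): in variables $x_{0j}$, $x_{ij}$, $y_{ii'j}$ ($i,i'\in\mathcal N$, $j\in\mathcal M$), maximize $\sum_{j\in\mathcal M}\sum_{i\in\mathcal N}\theta_jr_iv_{ij}x_{ij}$ subject to - $x_{0j}+\sum_{i\in\mathcal N}v_{ij}x_{ij}=1$ for all $j\in\mathcal M$; - $x_{ij}\le x_{0j}$ for all $i\in\mathcal N$, $j\in\mathcal M$; - $0\le y_{ii'j}\le x_{ij}$ and $y_{ii'j}\le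 x_{i'j}$ for all $i,i'\in\mathcal N$, $j\in\mathcal M$; - $\sum_{i\in C_k}\sum_{j\in\mathcal M}\theta_j\left(x_{ij}+\sum_{i'\in\mathcal N}v_{i'j}y_{ii'j}\right)\ge\ell_k$ for all $k\in\{1,\dots,K\}$. *)

theory Defs
  imports Complex_Main
begin

text \<open>
  Products are \<open>{1..n}\<close>, customer segments \<open>{1..m}\<close>, categories \<open>C 1, \<dots>, C K\<close>.  The preference
  weight of product \<open>i\<close> in segment \<open>j\<close> is \<open>v i j\<close>, and the weight of the no-purchase option is
  normalised to 1.
\<close>

definition seg_revenue :: "(nat \<Rightarrow> real) \<Rightarrow> (nat \<Rightarrow> nat \<Rightarrow> real) \<Rightarrow> nat \<Rightarrow> nat set \<Rightarrow> real" where
  "seg_revenue r v j S = (\<Sum>i\<in>S. r i * v i j) / (1 + (\<Sum>i\<in>S. v i j))"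


definition raoc_objective ::
  "nat \<Rightarrow> nat \<Rightarrow> (nat \<Rightarrow> real) \<Rightarrow> (nat \<Rightarrow> real) \<Rightarrow> (nat \<Rightarrow> nat \<Rightarrow> real) \<Rightarrow>
   (nat \<Rightarrow> nat set \<Rightarrow> real) \<Rightarrow> real" where
  "raoc_objective n m r \<theta> v q =
     (\<Sum>j=1..m. \<Sum>S\<in>Pow {1..n}. \<theta> j * seg_revenue r v j S * q j S)"

definition raoc_feasible ::
  "nat \<Rightarrow> nat \<Rightarrow> nat \<Rightarrow> (nat \<Rightarrow> real) \<Rightarrow> (nat \<Rightarrow> nat set) \<Rightarrow> (nat \<Rightarrow> real) \<Rightarrow>
   (nat \<Rightarrow> nat set \<Rightarrow> real) \<Rightarrow> bool" where
  "raoc_feasible n m K \<theta> C L q \<longleftrightarrow>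
     (\<forall>k\<in>{1..K}. (\<Sum>j=1..m. \<Sum>S\<in>Pow {1..n}. \<theta> j * real (card (S \<inter> C k)) * q j S) \<ge> L k) \<and>
     (\<forall>j\<in>{1..m}. (\<Sum>S\<in>Pow {1..n}. q j S) = 1) \<and>
     (\<forall>j\<in>{1..m}. \<forall>S\<in>Pow {1..n}. q j S \<ge> 0)"

definition raoc_optimal ::
  "nat \<Rightarrow> nat \<Rightarrow> nat \<Rightarrow> (nat \<Rightarrow> real) \<Rightarrow> (nat \<Rightarrow> real) \<Rightarrow> (nat \<Rightarrow> nat \<Rightarrow> real) \<Rightarrow>
   (nat \<Rightarrow> nat set) \<Rightarrow> (nat \<Rightarrow> real) \<Rightarrow> (nat \<Rightarrow> nat set \<Rightarrow> real) \<Rightarrow> bool" where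
  "raoc_optimal n m K r \<theta> v C L q \<longleftrightarrow>
     raoc_feasible n m K \<theta> C L q \<and>
     (\<forall>q'. raoc_feasible n m K \<theta> C L q' \<longrightarrow>
        raoc_objective n m r \<theta> v q' \<le> raoc_objective n m r \<theta> v q)"


text \<open>
  In the linear program the variable of the no-purchase option is \<open>x 0 j\<close>; index 0 is not a product.
\<close>

definition lp_objective ::
  "nat \<Rightarrow> nat \<Rightarrow> (nat \<Rightarrow> real) \<Rightarrow> (nat \<Rightarrow> real) \<Rightarrow> (nat \<Rightarrow> nat \<Rightarrow> real) \<Rightarrow>
   (nat \<Rightarrow> nat \<Rightarrow> real) \<Rightarrow> real" where
  "lp_objective n m r \<theta> v x = (\<Sum>j=1..m. \<Sum>i=1..n. \<theta> j * r i * v i j * x i j)"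

definition lp_feasible ::
  "nat \<Rightarrow> nat \<Rightarrow> nat \<Rightarrow> (nat \<Rightarrow> real) \<Rightarrow> (nat \<Rightarrow> nat \<Rightarrow> real) \<Rightarrow> (nat \<Rightarrow> nat set) \<Rightarrow>
   (nat \<Rightarrow> real) \<Rightarrow> (nat \<Rightarrow> nat \<Rightarrow> real) \<Rightarrow> (nat \<Rightarrow> nat \<Rightarrow> nat \<Rightarrow> real) \<Rightarrow> bool" where
  "lp_feasible n m K \<theta> v C L x y \<longleftrightarrow>
     (\<forall>j\<in>{1..m}. x 0 j + (\<Sum>i=1..n. v i j * x i j) = 1) \<and>
     (\<forall>i\<in>{1..n}. \<forall>j\<in>{1..m}. x i j \<le> x 0 j) \<and>
     (\<forall>i\<in>{1..n}. \<forall>i'\<in>{1..n}. \<forall>j\<in>{1..m}.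
        0 \<le> y i i' j \<and> y i i' j \<le> x i j \<and> y i i' j \<le> x i' j) \<and>
     (\<forall>k\<in>{1..K}. (\<Sum>i\<in>C k. \<Sum>j=1..m. \<theta> j * (x i j + (\<Sum>i'=1..n. v i' j * y i i' j))) \<ge> L k)"

definition lp_optimal ::
  "nat \<Rightarrow> nat \<Rightarrow> nat \<Rightarrow> (nat \<Rightarrow> real) \<Rightarrow> (nat \<Rightarrow> real) \<Rightarrow> (nat \<Rightarrow> nat \<Rightarrow> real) \<Rightarrow>
   (nat \<Rightarrow> nat set) \<Rightarrow> (nat \<Rightarrow> real) \<Rightarrow> (nat \<Rightarrow> nat \<Rightarrow> real) \<Rightarrow>
   (nat \<Rightarrow> nat \<Rightarrow> nat \<Rightarrow> real) \<Rightarrow> bool" where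
  "lp_optimal n m K r \<theta> v C L x y \<longleftrightarrow>
     lp_feasible n m K \<theta> v C L x y \<and>
     (\<forall>x' y'. lp_feasible n m K \<theta> v C L x' y' \<longrightarrow>
        lp_objective n m r \<theta> v x' \<le> lp_objective n m r \<theta> v x)"


text \<open>
  \<open>\<sigma> j s\<close> is the product in position \<open>s \<in> {1..n}\<close> of the ordering used for segment \<open>j\<close>, so
  \<open>chain \<sigma> j l\<close> consists of the first \<open>l\<close> products.
\<close>

definition chain :: "(nat \<Rightarrow> nat \<Rightarrow> nat) \<Rightarrow> nat \<Rightarrow> nat \<Rightarrow> nat set" where
  "chain \<sigma> j l = \<sigma> j ` {1..l}"

definition chain_prob ::
  "nat \<Rightarrow> (nat \<Rightarrow> nat \<Rightarrow> real) \<Rightarrow> (nat \<Rightarrow> nat \<Rightarrow> nat) \<Rightarrow> (nat \<Rightarrow> nat \<Rightarrow> real) \<Rightarrow>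
   nat \<Rightarrow> nat \<Rightarrow> real" where
  "chain_prob n v \<sigma> x j l =
     (1 + (\<Sum>s=1..l. v (\<sigma> j s) j)) *
     (x (\<sigma> j l) j - (if l = n then 0 else x (\<sigma> j (l + 1)) j))"

text \<open>
  The description below is unambiguous when \<open>\<sigma> j\<close> is a permutation of \<open>{1..n}\<close>; see
  \<open>q_star_chain\<close> and \<open>q_star_empty\<close>.
\<close>

definition q_star ::
  "nat \<Rightarrow> (nat \<Rightarrow> nat \<Rightarrow> real) \<Rightarrow> (nat \<Rightarrow> nat \<Rightarrow> nat) \<Rightarrow> (nat \<Rightarrow> nat \<Rightarrow> real) \<Rightarrow>
   nat \<Rightarrow> nat set \<Rightarrow> real" where
  "q_star n v \<sigma> x j S =
     (if \<exists>l\<in>{1..n}. S = chain \<sigma> j l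
        then chain_prob n v \<sigma> x j (THE l. l \<in> {1..n} \<and> S = chain \<sigma> j l)
      else if S = {} then 1 - (\<Sum>l=1..n. chain_prob n v \<sigma> x j l)
      else 0)"

lemma card_chain:
  assumes "bij_betw (\<sigma> j) {1..n} {1..n}" "l \<le> n"
  shows "card (chain \<sigma> j l) = l"
proof -
  have "inj_on (\<sigma> j) {1..l}"
    using assms by (auto simp: bij_betw_def intro: inj_on_subset)
  then show ?thesis
    by (simp add: chain_def card_image)
qed

lemma q_star_chain:
  assumes "bij_betw (\<sigma> j) {1..n} {1..n}" "l \<in> {1..n}"
  shows "q_star n v \<sigma> x j (chain \<sigma> j l) = chain_prob n v \<sigma> x j l"
proof -
  have "(THE l'. l' \<in> {1..n} \<and> chain \<sigma> j l = chain \<sigma> j l') = l"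
  proof (rule the_equality)
    show "l \<in> {1..n} \<and> chain \<sigma> j l = chain \<sigma> j l"
      using assms(2) by simp
    fix l' assume "l' \<in> {1..n} \<and> chain \<sigma> j l = chain \<sigma> j l'"
    then show "l' = l"
      using card_chain[of \<sigma> j n l] card_chain[of \<sigma> j n l'] assms by simp
  qed
  moreover have "\<exists>l'\<in>{1..n}. chain \<sigma> j l = chain \<sigma> j l'"
    using assms(2) by blast
  ultimately show ?thesis
    by (simp add: q_star_def)
qed

lemma q_star_empty:
  assumes "bij_betw (\<sigma> j) {1..n} {1..n}"
  shows "q_star n v \<sigma> x j {} = 1 - (\<Sum>l=1..n. q_star n v \<sigma> x j (chain \<sigma> j l))"
proof -
  have "\<not> (\<exists>l\<in>{1..n}. {} = chain \<sigma> j l)"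
    by (auto simp: chain_def)
  moreover have "(\<Sum>l=1..n. q_star n v \<sigma> x j (chain \<sigma> j l)) = (\<Sum>l=1..n. chain_prob n v \<sigma> x j l)"
    by (intro sum.cong refl q_star_chain assms)
  ultimately show ?thesis
    by (simp add: q_star_def)
qed

end

theory Submission
  imports Defs
begin

text \<open>
  The linear program describes (m-RAOC) through a few moments of the assortment distributions.  For
  one segment with weights \<open>w\<close> and a randomised assortment \<open>q\<close>, attach to every assortment \<open>S\<close>
  the probability \<open>q S / (1 + sum w S)\<close> that \<open>S\<close> is offered and nothing is bought, and let
  \<open>mass A\<close> be the total of these probabilities over the assortments containing \<open>A\<close>.  Then
  \<open>x 0 = mass {}\<close>, \<open>x i = mass {i}\<close> and \<open>y i i' = mass {i, i'}\<close> satisfy the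
  constraints of the linear program: multiplying \<open>q S / (1 + sum w S)\<close> by \<open>1 + sum w S\<close> and
  exchanging sums gives, in \<open>mass_plus_weighted_mass_insert\<close>, both the normalisation (\<open>A = {}\<close>) and
  the probability that product \<open>i\<close> is offered (\<open>A = {i}\<close>), which is what the coverage constraints
  count.  Revenue is linear in the \<open>x i\<close> by the same exchange.  So every feasible \<open>q\<close> yields a
  feasible point of the linear program with the same objective value, and the optimal value of
  (m-RAOC) is at most that of the linear program.

  Conversely, \<open>q_star\<close> spreads mass over the nested sets of products with the largest \<open>x i\<close> in such a
  way that \<open>mass\<close> returns the given \<open>x\<close>: the masses telescope.  Nestedness makes \<open>mass {i, i'}\<close> equal to
  the smaller of \<open>x i\<close> and \<open>x i'\<close>, the largest value which the linear program allows for \<open>y i i'\<close>, so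
  \<open>q_star\<close> covers each category at least as well as \<open>(x, y)\<close> does.  Hence \<open>q_star\<close> is feasible and
  attains the optimal value of the linear program.
\<close>


section \<open>Moments of a randomised assortment\<close>

definition mass :: "nat set \<Rightarrow> (nat \<Rightarrow> real) \<Rightarrow> (nat set \<Rightarrow> real) \<Rightarrow> nat set \<Rightarrow> real" where
  "mass N w q A = (\<Sum>S | S \<subseteq> N \<and> A \<subseteq> S. q S / (1 + sum w S))"

lemma sum_subsets_weighted_swap:
  fixes g :: "nat \<Rightarrow> real"
  assumes "finite N"
  shows "(\<Sum>S | S \<subseteq> N \<and> A \<subseteq> S. sum g S * p S)
       = (\<Sum>i\<in>N. g i * (\<Sum>S | S \<subseteq> N \<and> insert i A \<subseteq> S. p S))"
proof -
  have fin: "finite {S. S \<subseteq> N \<and> A \<subseteq> S}"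
    using assms by simp
  have "(\<Sum>S | S \<subseteq> N \<and> A \<subseteq> S. sum g S * p S)
      = (\<Sum>S | S \<subseteq> N \<and> A \<subseteq> S. \<Sum>i\<in>{i\<in>N. i \<in> S}. g i * p S)"
    by (intro sum.cong refl) (auto simp: sum_distrib_right intro!: sum.cong)
  also have "\<dots> = (\<Sum>i\<in>N. \<Sum>S\<in>{S\<in>{S. S \<subseteq> N \<and> A \<subseteq> S}. i \<in> S}. g i * p S)"
    by (rule sum.swap_restrict[OF fin assms])
  also have "\<dots> = (\<Sum>i\<in>N. g i * (\<Sum>S | S \<subseteq> N \<and> insert i A \<subseteq> S. p S))"
    by (intro sum.cong refl) (auto simp: sum_distrib_left intro!: sum.cong)
  finally show ?thesis .
qed

text \<open>
  The factor \<open>1 + sum w S\<close> cancels the denominator in \<open>mass\<close>; its two parts give the two terms on the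
  left.
\<close>

lemma mass_plus_weighted_mass_insert:
  assumes "finite N" "\<And>i. i \<in> N \<Longrightarrow> 0 \<le> w i"
  shows "mass N w q A + (\<Sum>i\<in>N. w i * mass N w q (insert i A)) = (\<Sum>S | S \<subseteq> N \<and> A \<subseteq> S. q S)"
proof -
  have "mass N w q A + (\<Sum>i\<in>N. w i * mass N w q (insert i A))
      = (\<Sum>S | S \<subseteq> N \<and> A \<subseteq> S. (1 + sum w S) * (q S / (1 + sum w S)))"
    unfolding mass_def sum_subsets_weighted_swap[OF assms(1), symmetric]
    by (simp only: sum.distrib[symmetric] distrib_right mult_1)
  also have "\<dots> = (\<Sum>S | S \<subseteq> N \<and> A \<subseteq> S. q S)"
  proof (intro sum.cong refl)
    fix S assume "S \<in> {S. S \<subseteq> N \<and> A \<subseteq> S}"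
    then have "0 \<le> sum w S"
      using assms(2) by (intro sum_nonneg) auto
    then show "(1 + sum w S) * (q S / (1 + sum w S)) = q S"
      by simp
  qed
  finally show ?thesis .
qed

lemma sum_eq_mass:
  assumes "finite N" "\<And>i. i \<in> N \<Longrightarrow> 0 \<le> w i"
  shows "(\<Sum>S\<in>Pow N. q S) = mass N w q {} + (\<Sum>i\<in>N. w i * mass N w q {i})"
  using mass_plus_weighted_mass_insert[of N w q "{}"] assms by (simp add: Pow_def)

lemma coverage_eq_mass:
  assumes "finite N" "\<And>i. i \<in> N \<Longrightarrow> 0 \<le> w i" "D \<subseteq> N"
  shows "(\<Sum>S\<in>Pow N. real (card (S \<inter> D)) * q S)
       = (\<Sum>i\<in>D. mass N w q {i} + (\<Sum>i'\<in>N. w i' * mass N w q {i, i'}))"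
proof -
  have "(\<Sum>S\<in>Pow N. real (card (S \<inter> D)) * q S)
      = (\<Sum>S | S \<subseteq> N \<and> {} \<subseteq> S. sum (\<lambda>i. of_bool (i \<in> D)) S * q S)"
  proof (rule sum.cong)
    fix S assume "S \<in> {S. S \<subseteq> N \<and> {} \<subseteq> S}"
    then have "finite S"
      using assms(1) finite_subset by auto
    then show "real (card (S \<inter> D)) * q S = sum (\<lambda>i. of_bool (i \<in> D)) S * q S"
      by (simp add: Int_def of_bool_def sum.If_cases)
  qed (simp add: Pow_def)
  also have "\<dots> = (\<Sum>i\<in>N. of_bool (i \<in> D) * (\<Sum>S | S \<subseteq> N \<and> {i} \<subseteq> S. q S))"
    by (rule sum_subsets_weighted_swap[OF assms(1)])
  also have "\<dots> = (\<Sum>i\<in>D. \<Sum>S | S \<subseteq> N \<and> {i} \<subseteq> S. q S)"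
    using assms(1,3) by (intro sum.mono_neutral_cong_right) auto
  also have "\<dots> = (\<Sum>i\<in>D. mass N w q {i} + (\<Sum>i'\<in>N. w i' * mass N w q {i, i'}))"
    by (simp only: mass_plus_weighted_mass_insert[OF assms(1,2), symmetric] insert_commute)
  finally show ?thesis .
qed

lemma revenue_eq_mass:
  assumes "finite N"
  shows "(\<Sum>S\<in>Pow N. seg_revenue r v j S * q S)
       = (\<Sum>i\<in>N. r i * v i j * mass N (\<lambda>i. v i j) q {i})"
proof -
  have "(\<Sum>S\<in>Pow N. seg_revenue r v j S * q S)
      = (\<Sum>S | S \<subseteq> N \<and> {} \<subseteq> S. (\<Sum>i\<in>S. r i * v i j) * (q S / (1 + (\<Sum>i\<in>S. v i j))))"
    by (simp add: Pow_def seg_revenue_def)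
  also have "\<dots> = (\<Sum>i\<in>N. r i * v i j * mass N (\<lambda>i. v i j) q {i})"
    unfolding mass_def by (rule sum_subsets_weighted_swap[OF assms])
  finally show ?thesis .
qed

lemma mass_term_nonneg:
  fixes w :: "nat \<Rightarrow> real" and q :: "nat set \<Rightarrow> real"
  assumes "\<And>i. i \<in> N \<Longrightarrow> 0 \<le> w i" "\<And>S. S \<subseteq> N \<Longrightarrow> 0 \<le> q S" "S \<subseteq> N"
  shows "0 \<le> q S / (1 + sum w S)"
proof -
  have "0 \<le> sum w S"
    using assms by (intro sum_nonneg) auto
  then show ?thesis
    using assms by (intro divide_nonneg_nonneg) auto
qed

lemma mass_nonneg:
  assumes "\<And>i. i \<in> N \<Longrightarrow> 0 \<le> w i" "\<And>S. S \<subseteq> N \<Longrightarrow> 0 \<le> q S"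
  shows "0 \<le> mass N w q A"
  unfolding mass_def using mass_term_nonneg[of N w q] assms by (intro sum_nonneg) auto

lemma mass_antimono:
  assumes "finite N" "\<And>i. i \<in> N \<Longrightarrow> 0 \<le> w i" "\<And>S. S \<subseteq> N \<Longrightarrow> 0 \<le> q S" "A \<subseteq> B"
  shows "mass N w q B \<le> mass N w q A"
  unfolding mass_def using mass_term_nonneg[of N w q] assms
  by (intro sum_mono2) auto


section \<open>The linear program is a relaxation\<close>

text \<open>
  Index 0 is the no-purchase option, which belongs to every assortment; hence the empty set.
\<close>

definition lp_x ::
  "nat \<Rightarrow> (nat \<Rightarrow> nat \<Rightarrow> real) \<Rightarrow> (nat \<Rightarrow> nat set \<Rightarrow> real) \<Rightarrow> nat \<Rightarrow> nat \<Rightarrow> real" where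
  "lp_x n v q i j = mass {1..n} (\<lambda>i. v i j) (q j) (if i = 0 then {} else {i})"

definition lp_y ::
  "nat \<Rightarrow> (nat \<Rightarrow> nat \<Rightarrow> real) \<Rightarrow> (nat \<Rightarrow> nat set \<Rightarrow> real) \<Rightarrow> nat \<Rightarrow> nat \<Rightarrow> nat \<Rightarrow> real" where
  "lp_y n v q i i' j = mass {1..n} (\<lambda>i. v i j) (q j) {i, i'}"

lemma lp_x_simps:
  "lp_x n v q 0 j = mass {1..n} (\<lambda>i. v i j) (q j) {}"
  "i \<noteq> 0 \<Longrightarrow> lp_x n v q i j = mass {1..n} (\<lambda>i. v i j) (q j) {i}"
  by (simp_all add: lp_x_def)

lemma lp_normalisation:
  assumes "\<forall>i\<in>{1..n}. v i j > 0"
  shows "lp_x n v q 0 j + (\<Sum>i=1..n. v i j * lp_x n v q i j) = (\<Sum>S\<in>Pow {1..n}. q j S)"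
proof -
  have "(\<Sum>i=1..n. v i j * lp_x n v q i j)
      = (\<Sum>i=1..n. v i j * mass {1..n} (\<lambda>i. v i j) (q j) {i})"
    by (intro sum.cong refl) (simp add: lp_x_simps)
  then show ?thesis
    using sum_eq_mass[of "{1..n}" "\<lambda>i. v i j" "q j"] assms
    by (simp add: lp_x_simps less_imp_le)
qed

lemma raoc_coverage_eq_lp:
  assumes "\<forall>i\<in>{1..n}. \<forall>j\<in>{1..m}. v i j > 0" "D \<subseteq> {1..n}"
  shows "(\<Sum>j=1..m. \<Sum>S\<in>Pow {1..n}. \<theta> j * real (card (S \<inter> D)) * q j S)
       = (\<Sum>i\<in>D. \<Sum>j=1..m. \<theta> j *
            (lp_x n v q i j + (\<Sum>i'=1..n. v i' j * lp_y n v q i i' j)))"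
proof -
  have "(\<Sum>S\<in>Pow {1..n}. \<theta> j * real (card (S \<inter> D)) * q j S)
      = (\<Sum>i\<in>D. \<theta> j * (lp_x n v q i j + (\<Sum>i'=1..n. v i' j * lp_y n v q i i' j)))"
    if "j \<in> {1..m}" for j
  proof -
    have "(\<Sum>S\<in>Pow {1..n}. \<theta> j * real (card (S \<inter> D)) * q j S)
        = \<theta> j * (\<Sum>S\<in>Pow {1..n}. real (card (S \<inter> D)) * q j S)"
      by (simp add: sum_distrib_left mult.assoc)
    also have "(\<Sum>S\<in>Pow {1..n}. real (card (S \<inter> D)) * q j S)
        = (\<Sum>i\<in>D. mass {1..n} (\<lambda>i. v i j) (q j) {i}
            + (\<Sum>i'=1..n. v i' j * mass {1..n} (\<lambda>i. v i j) (q j) {i, i'}))"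
      using assms that by (intro coverage_eq_mass) (auto intro: less_imp_le)
    also have "\<dots> = (\<Sum>i\<in>D. lp_x n v q i j + (\<Sum>i'=1..n. v i' j * lp_y n v q i i' j))"
    proof (intro sum.cong refl)
      fix i assume "i \<in> D"
      then have "i \<noteq> 0"
        using assms(2) by auto
      then show "mass {1..n} (\<lambda>i. v i j) (q j) {i}
            + (\<Sum>i'=1..n. v i' j * mass {1..n} (\<lambda>i. v i j) (q j) {i, i'})
          = lp_x n v q i j + (\<Sum>i'=1..n. v i' j * lp_y n v q i i' j)"
        by (simp add: lp_x_simps lp_y_def)
    qed
    finally show ?thesis
      by (simp add: sum_distrib_left)
  qed
  then have "(\<Sum>j=1..m. \<Sum>S\<in>Pow {1..n}. \<theta> j * real (card (S \<inter> D)) * q j S)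
      = (\<Sum>j=1..m. \<Sum>i\<in>D. \<theta> j *
            (lp_x n v q i j + (\<Sum>i'=1..n. v i' j * lp_y n v q i i' j)))"
    by (intro sum.cong) auto
  also have "\<dots> = (\<Sum>i\<in>D. \<Sum>j=1..m. \<theta> j *
            (lp_x n v q i j + (\<Sum>i'=1..n. v i' j * lp_y n v q i i' j)))"
    by (rule sum.swap)
  finally show ?thesis .
qed

lemma raoc_objective_eq_lp:
  "raoc_objective n m r \<theta> v q = lp_objective n m r \<theta> v (lp_x n v q)"
  unfolding raoc_objective_def lp_objective_def
proof (intro sum.cong refl)
  fix j
  have "(\<Sum>S\<in>Pow {1..n}. \<theta> j * seg_revenue r v j S * q j S)
      = \<theta> j * (\<Sum>i=1..n. r i * v i j * mass {1..n} (\<lambda>i. v i j) (q j) {i})"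
    unfolding revenue_eq_mass[OF finite_atLeastAtMost, symmetric]
    by (simp add: sum_distrib_left mult.assoc)
  also have "\<dots> = (\<Sum>i=1..n. \<theta> j * r i * v i j * lp_x n v q i j)"
    unfolding sum_distrib_left by (intro sum.cong refl) (simp add: lp_x_simps)
  finally show "(\<Sum>S\<in>Pow {1..n}. \<theta> j * seg_revenue r v j S * q j S)
      = (\<Sum>i=1..n. \<theta> j * r i * v i j * lp_x n v q i j)" .
qed

lemma raoc_feasible_imp_lp_feasible:
  assumes v: "\<forall>i\<in>{1..n}. \<forall>j\<in>{1..m}. v i j > 0"
    and C: "\<forall>k\<in>{1..K}. C k \<subseteq> {1..n}"
    and q: "raoc_feasible n m K \<theta> C L q"
  shows "lp_feasible n m K \<theta> v C L (lp_x n v q) (lp_y n v q)"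
  unfolding lp_feasible_def
proof (intro conjI ballI)
  fix j assume j: "j \<in> {1..m}"
  then have "\<forall>i\<in>{1..n}. v i j > 0"
    using v by blast
  then show "lp_x n v q 0 j + (\<Sum>i=1..n. v i j * lp_x n v q i j) = 1"
    using q j by (simp only: lp_normalisation raoc_feasible_def)
next
  fix i j assume "i \<in> {1..n}" and j: "j \<in> {1..m}"
  then show "lp_x n v q i j \<le> lp_x n v q 0 j"
    unfolding lp_x_def using v q
    by (intro mass_antimono) (auto simp: raoc_feasible_def intro: less_imp_le)
next
  fix i i' j assume *: "i \<in> {1..n}" "i' \<in> {1..n}" and j: "j \<in> {1..m}"
  show "0 \<le> lp_y n v q i i' j"
    unfolding lp_y_def using v q j
    by (intro mass_nonneg) (auto simp: raoc_feasible_def intro: less_imp_le)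
  show "lp_y n v q i i' j \<le> lp_x n v q i j"
    unfolding lp_x_def lp_y_def using v q j *
    by (intro mass_antimono) (auto simp: raoc_feasible_def intro: less_imp_le)
  show "lp_y n v q i i' j \<le> lp_x n v q i' j"
    unfolding lp_x_def lp_y_def using v q j *
    by (intro mass_antimono) (auto simp: raoc_feasible_def intro: less_imp_le)
next
  fix k assume k: "k \<in> {1..K}"
  then have Ck: "C k \<subseteq> {1..n}"
    using C by blast
  show "L k \<le> (\<Sum>i\<in>C k. \<Sum>j=1..m. \<theta> j *
      (lp_x n v q i j + (\<Sum>i'=1..n. v i' j * lp_y n v q i i' j)))"
    using q k unfolding raoc_coverage_eq_lp[OF v Ck, symmetric] raoc_feasible_def by blast
qed


section \<open>Recovering the linear program from nested assortments\<close>

lemma chain_0 [simp]: "chain \<sigma> j 0 = {}"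
  by (simp add: chain_def)

lemma chain_subset:
  assumes "bij_betw (\<sigma> j) {1..n} {1..n}" "l \<le> n"
  shows "chain \<sigma> j l \<subseteq> {1..n}"
  using assms by (auto simp: chain_def bij_betw_def)

lemma inj_on_chain:
  assumes "bij_betw (\<sigma> j) {1..n} {1..n}"
  shows "inj_on (chain \<sigma> j) {..n}"
  using card_chain[where \<sigma> = \<sigma>, OF assms] by (intro inj_onI) (metis atMost_iff)

lemma mem_chain_iff:
  assumes "bij_betw (\<sigma> j) {1..n} {1..n}" "s \<in> {1..n}" "l \<le> n"
  shows "\<sigma> j s \<in> chain \<sigma> j l \<longleftrightarrow> s \<le> l"
proof -
  have "\<sigma> j s \<in> \<sigma> j ` {1..l} \<longleftrightarrow> s \<in> {1..l}"
    using assms by (intro inj_on_image_mem_iff[of _ "{1..n}"]) (auto simp: bij_betw_def)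
  then show ?thesis
    using assms(2) by (simp add: chain_def)
qed

lemma q_star_eq_0:
  assumes "S \<notin> chain \<sigma> j ` {..n}"
  shows "q_star n v \<sigma> x j S = 0"
proof -
  have "\<not> (\<exists>l\<in>{1..n}. S = chain \<sigma> j l)"
    using assms by auto
  moreover have "S \<noteq> {}"
    using assms chain_0[of \<sigma> j] by (metis atMost_iff image_eqI le0)
  ultimately show ?thesis
    by (simp add: q_star_def)
qed

lemma sum_q_star:
  assumes "bij_betw (\<sigma> j) {1..n} {1..n}"
  shows "(\<Sum>S\<in>Pow {1..n}. F S * q_star n v \<sigma> x j S)
       = F {} * q_star n v \<sigma> x j {}
         + (\<Sum>l=1..n. F (chain \<sigma> j l) * chain_prob n v \<sigma> x j l)"
proof -
  have "(\<Sum>S\<in>Pow {1..n}. F S * q_star n v \<sigma> x j S)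
      = (\<Sum>S\<in>chain \<sigma> j ` {..n}. F S * q_star n v \<sigma> x j S)"
    using chain_subset[where \<sigma> = \<sigma>, OF assms]
    by (intro sum.mono_neutral_right) (auto simp: q_star_eq_0)
  also have "\<dots> = (\<Sum>l\<le>n. F (chain \<sigma> j l) * q_star n v \<sigma> x j (chain \<sigma> j l))"
    using inj_on_chain[where \<sigma> = \<sigma>, OF assms] by (simp add: sum.reindex)
  also have "\<dots> = F {} * q_star n v \<sigma> x j {}
      + (\<Sum>l=1..n. F (chain \<sigma> j l) * q_star n v \<sigma> x j (chain \<sigma> j l))"
    by (simp add: atMost_atLeast0 sum.atLeast_Suc_atMost)
  also have "(\<Sum>l=1..n. F (chain \<sigma> j l) * q_star n v \<sigma> x j (chain \<sigma> j l))
      = (\<Sum>l=1..n. F (chain \<sigma> j l) * chain_prob n v \<sigma> x j l)"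
    using assms by (intro sum.cong refl) (simp add: q_star_chain)
  finally show ?thesis .
qed

lemma sum_q_star_eq_1:
  assumes "bij_betw (\<sigma> j) {1..n} {1..n}"
  shows "(\<Sum>S\<in>Pow {1..n}. q_star n v \<sigma> x j S) = 1"
proof -
  have "q_star n v \<sigma> x j {} = 1 - (\<Sum>l=1..n. chain_prob n v \<sigma> x j l)"
    unfolding q_star_empty[where \<sigma> = \<sigma>, OF assms]
    using assms by (intro arg_cong2[where f = "(-)"] sum.cong refl) (simp add: q_star_chain)
  then show ?thesis
    using sum_q_star[where \<sigma> = \<sigma>, OF assms, of "\<lambda>_. 1" v x] by simp
qed

definition step_down :: "nat \<Rightarrow> (nat \<Rightarrow> nat \<Rightarrow> nat) \<Rightarrow> (nat \<Rightarrow> nat \<Rightarrow> real) \<Rightarrow> nat \<Rightarrow> nat \<Rightarrow> real"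
  where "step_down n \<sigma> x j l = x (\<sigma> j l) j - (if l = n then 0 else x (\<sigma> j (l + 1)) j)"

lemma sum_step_down:
  assumes "p \<le> n"
  shows "(\<Sum>l=p..n. step_down n \<sigma> x j l) = x (\<sigma> j p) j"
proof -
  let ?f = "\<lambda>l. if l \<le> n then x (\<sigma> j l) j else 0"
  have "(\<Sum>l=p..n. step_down n \<sigma> x j l) = (\<Sum>l=p..n. ?f l - ?f (Suc l))"
    by (intro sum.cong refl) (auto simp: step_down_def)
  also have "\<dots> = ?f p - ?f (Suc n)"
    using assms sum_Suc_diff[of p n "\<lambda>l. - ?f l"] by simp
  finally show ?thesis
    using assms by simp
qed

text \<open>
  The factor \<open>1 + \<dots>\<close> in \<open>chain_prob\<close> is the denominator in \<open>mass\<close>, so the \<open>l\<close>-th nested set carries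
  the mass \<open>step_down n \<sigma> x j l\<close>.
\<close>

lemma mass_q_star:
  assumes bij: "bij_betw (\<sigma> j) {1..n} {1..n}" and v: "\<forall>i\<in>{1..n}. v i j > 0"
  shows "mass {1..n} (\<lambda>i. v i j) (q_star n v \<sigma> x j) A
       = of_bool (A = {}) * q_star n v \<sigma> x j {}
         + (\<Sum>l=1..n. of_bool (A \<subseteq> chain \<sigma> j l) * step_down n \<sigma> x j l)"
proof -
  let ?F = "\<lambda>S. of_bool (A \<subseteq> S) / (1 + (\<Sum>i\<in>S. v i j))"
  have "mass {1..n} (\<lambda>i. v i j) (q_star n v \<sigma> x j) A
      = (\<Sum>S\<in>Pow {1..n}. ?F S * q_star n v \<sigma> x j S)"
    unfolding mass_def by (intro sum.mono_neutral_cong_left) auto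
  also have "\<dots> = ?F {} * q_star n v \<sigma> x j {}
      + (\<Sum>l=1..n. ?F (chain \<sigma> j l) * chain_prob n v \<sigma> x j l)"
    by (rule sum_q_star[where \<sigma> = \<sigma>, OF bij])
  also have "(\<Sum>l=1..n. ?F (chain \<sigma> j l) * chain_prob n v \<sigma> x j l)
      = (\<Sum>l=1..n. of_bool (A \<subseteq> chain \<sigma> j l) * step_down n \<sigma> x j l)"
  proof (intro sum.cong refl)
    fix l assume l: "l \<in> {1..n}"
    have "inj_on (\<sigma> j) {1..l}"
      using bij l by (auto simp: bij_betw_def intro: inj_on_subset)
    then have "(\<Sum>i\<in>chain \<sigma> j l. v i j) = (\<Sum>s=1..l. v (\<sigma> j s) j)"
      by (simp add: chain_def sum.reindex)
    moreover have "0 \<le> (\<Sum>i\<in>chain \<sigma> j l. v i j)"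
      using chain_subset[where \<sigma> = \<sigma>, OF bij] l v by (intro sum_nonneg less_imp_le) auto
    ultimately show "?F (chain \<sigma> j l) * chain_prob n v \<sigma> x j l
        = of_bool (A \<subseteq> chain \<sigma> j l) * step_down n \<sigma> x j l"
      by (simp add: chain_prob_def step_down_def)
  qed
  finally show ?thesis
    by simp
qed

text \<open>
  A nested set contains two given products as soon as it contains the later one, so the sum of masses
  telescopes to the value of \<open>x\<close> at the later product.
\<close>

lemma mass_q_star_pair:
  assumes bij: "bij_betw (\<sigma> j) {1..n} {1..n}" and v: "\<forall>i\<in>{1..n}. v i j > 0"
    and st: "s \<in> {1..n}" "t \<in> {1..n}"
  shows "mass {1..n} (\<lambda>i. v i j) (q_star n v \<sigma> x j) {\<sigma> j s, \<sigma> j t} = x (\<sigma> j (max s t)) j"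
proof -
  have "mass {1..n} (\<lambda>i. v i j) (q_star n v \<sigma> x j) {\<sigma> j s, \<sigma> j t}
      = (\<Sum>l=1..n. of_bool ({\<sigma> j s, \<sigma> j t} \<subseteq> chain \<sigma> j l) * step_down n \<sigma> x j l)"
    using mass_q_star[where \<sigma> = \<sigma> and v = v and j = j, OF bij v, of x "{\<sigma> j s, \<sigma> j t}"]
    by simp
  also have "\<dots> = (\<Sum>l=max s t..n. step_down n \<sigma> x j l)"
    using st by (intro sum.mono_neutral_cong_right)
      (auto simp: mem_chain_iff[where \<sigma> = \<sigma>, OF bij])
  also have "\<dots> = x (\<sigma> j (max s t)) j"
    using st by (intro sum_step_down) auto
  finally show ?thesis .
qed

lemma lp_x_q_star:
  assumes bij: "bij_betw (\<sigma> j) {1..n} {1..n}" and v: "\<forall>i\<in>{1..n}. v i j > 0"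
    and i: "i \<in> {1..n}"
  shows "lp_x n v (q_star n v \<sigma> x) i j = x i j"
proof -
  obtain s where "s \<in> {1..n}" "i = \<sigma> j s"
    using bij_betw_imp_surj_on[OF bij] i by (metis imageE)
  then show ?thesis
    using mass_q_star_pair[where \<sigma> = \<sigma> and v = v and j = j, OF bij v, of s s x] i
    by (simp add: lp_x_def)
qed

text \<open>
  The pair mass is one of the two values of \<open>x\<close>, so it dominates every \<open>y i i' j\<close> which the linear
  program admits next to \<open>x\<close>.
\<close>

lemma le_lp_y_q_star:
  assumes bij: "bij_betw (\<sigma> j) {1..n} {1..n}" and v: "\<forall>i\<in>{1..n}. v i j > 0"
    and i: "i \<in> {1..n}" "i' \<in> {1..n}" and z: "z \<le> x i j" "z \<le> x i' j"
  shows "z \<le> lp_y n v (q_star n v \<sigma> x) i i' j"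
proof -
  obtain s t where "s \<in> {1..n}" "i = \<sigma> j s" "t \<in> {1..n}" "i' = \<sigma> j t"
    using bij_betw_imp_surj_on[OF bij] i by (metis imageE)
  then show ?thesis
    using mass_q_star_pair[where \<sigma> = \<sigma> and v = v and j = j, OF bij v, of s t x] z
    by (simp add: lp_y_def max_def)
qed

text \<open>
  Both sides are what normalisation leaves for the no-purchase option, because the product variables
  agree.
\<close>

lemma lp_x_q_star_no_purchase:
  assumes bij: "bij_betw (\<sigma> j) {1..n} {1..n}" and v: "\<forall>i\<in>{1..n}. v i j > 0"
    and norm: "x 0 j + (\<Sum>i=1..n. v i j * x i j) = 1"
  shows "lp_x n v (q_star n v \<sigma> x) 0 j = x 0 j"
proof -
  have "(\<Sum>i=1..n. v i j * lp_x n v (q_star n v \<sigma> x) i j) = (\<Sum>i=1..n. v i j * x i j)"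
    using lp_x_q_star[where \<sigma> = \<sigma> and v = v and j = j, OF bij v] by (intro sum.cong refl) simp
  then show ?thesis
    using lp_normalisation[where v = v and j = j, OF v, of "q_star n v \<sigma> x"]
      sum_q_star_eq_1[where \<sigma> = \<sigma>, OF bij] norm
    by simp
qed

text \<open>
  The mass of the empty assortment is \<open>x 0 j\<close> minus the telescoped mass of the other nested sets,
  which is the largest \<open>x i j\<close>, or 0 if there are no products.
\<close>

lemma q_star_nonneg:
  assumes bij: "bij_betw (\<sigma> j) {1..n} {1..n}" and v: "\<forall>i\<in>{1..n}. v i j > 0"
    and norm: "x 0 j + (\<Sum>i=1..n. v i j * x i j) = 1"
    and le: "\<forall>i\<in>{1..n}. x i j \<le> x 0 j" and nonneg: "\<forall>i\<in>{1..n}. 0 \<le> x i j"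
    and mono: "\<forall>l\<in>{1..<n}. x (\<sigma> j l) j \<ge> x (\<sigma> j (l + 1)) j"
  shows "0 \<le> q_star n v \<sigma> x j S"
proof (cases "S \<in> chain \<sigma> j ` {..n}")
  case False
  then show ?thesis
    by (simp add: q_star_eq_0)
next
  case True
  then obtain l where l: "l \<le> n" "S = chain \<sigma> j l"
    by auto
  have \<sigma>: "\<sigma> j s \<in> {1..n}" if "s \<in> {1..n}" for s
    using bij that by (auto simp: bij_betw_def)
  show ?thesis
  proof (cases "l = 0")
    case True
    have empty: "x 0 j = q_star n v \<sigma> x j {} + (\<Sum>l=1..n. step_down n \<sigma> x j l)"
      using mass_q_star[where \<sigma> = \<sigma> and v = v and j = j, OF bij v, of x "{}"]
        lp_x_q_star_no_purchase[where \<sigma> = \<sigma> and v = v and x = x and j = j, OF bij v norm]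
      by (simp add: lp_x_simps)
    have "(\<Sum>l=1..n. step_down n \<sigma> x j l) \<le> x 0 j"
    proof (cases "n = 0")
      case True
      then show ?thesis
        using norm by simp
    next
      case False
      then show ?thesis
        using sum_step_down[of 1 n \<sigma> x j] le \<sigma>[of 1] by simp
    qed
    then show ?thesis
      using empty l True by simp
  next
    case False
    then have l': "l \<in> {1..n}"
      using l by simp
    have "0 \<le> (\<Sum>s=1..l. v (\<sigma> j s) j)"
      using \<sigma> v l by (intro sum_nonneg less_imp_le) auto
    moreover have "0 \<le> x (\<sigma> j l) j - (if l = n then 0 else x (\<sigma> j (l + 1)) j)"
      using nonneg \<sigma>[OF l'] mono l' by auto
    ultimately show ?thesis
      using q_star_chain[where \<sigma> = \<sigma>, OF bij l'] l by (simp add: chain_prob_def)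
  qed
qed


section \<open>Optimality\<close>

lemma q_star_feasible:
  assumes \<theta>: "\<forall>j\<in>{1..m}. \<theta> j \<ge> 0"
    and v: "\<forall>i\<in>{1..n}. \<forall>j\<in>{1..m}. v i j > 0"
    and C: "\<forall>k\<in>{1..K}. C k \<subseteq> {1..n}"
    and lp: "lp_feasible n m K \<theta> v C L x y"
    and bij: "\<forall>j\<in>{1..m}. bij_betw (\<sigma> j) {1..n} {1..n}"
    and mono: "\<forall>j\<in>{1..m}. \<forall>l\<in>{1..<n}. x (\<sigma> j l) j \<ge> x (\<sigma> j (l + 1)) j"
  shows "raoc_feasible n m K \<theta> C L (q_star n v \<sigma> x)"
  unfolding raoc_feasible_def
proof (intro conjI ballI)
  fix k assume k: "k \<in> {1..K}"
  let ?q = "q_star n v \<sigma> x"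
  have "L k \<le> (\<Sum>i\<in>C k. \<Sum>j=1..m. \<theta> j * (x i j + (\<Sum>i'=1..n. v i' j * y i i' j)))"
    using lp k by (simp add: lp_feasible_def)
  also have "\<dots> \<le> (\<Sum>i\<in>C k. \<Sum>j=1..m. \<theta> j *
      (lp_x n v ?q i j + (\<Sum>i'=1..n. v i' j * lp_y n v ?q i i' j)))"
  proof (intro sum_mono mult_left_mono add_mono)
    fix i j assume i: "i \<in> C k" and j: "j \<in> {1..m}"
    have i': "i \<in> {1..n}"
      using i k C by blast
    have vj: "\<forall>i\<in>{1..n}. v i j > 0" and bj: "bij_betw (\<sigma> j) {1..n} {1..n}"
      using v bij j by auto
    show "x i j \<le> lp_x n v ?q i j"
      using lp_x_q_star[where \<sigma> = \<sigma> and v = v and j = j, OF bj vj i'] by simp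
    show "0 \<le> \<theta> j"
      using \<theta> j by simp
    fix i' assume i2: "i' \<in> {1..n}"
    show "y i i' j \<le> lp_y n v ?q i i' j"
      using lp i' i2 j by (intro le_lp_y_q_star bj vj) (auto simp: lp_feasible_def)
    show "0 \<le> v i' j"
      using vj i2 by (simp add: less_imp_le)
  qed
  also have "\<dots> = (\<Sum>j=1..m. \<Sum>S\<in>Pow {1..n}. \<theta> j * real (card (S \<inter> C k)) * ?q j S)"
    using C k by (simp only: raoc_coverage_eq_lp[OF v])
  finally show "L k \<le> (\<Sum>j=1..m. \<Sum>S\<in>Pow {1..n}. \<theta> j * real (card (S \<inter> C k)) * ?q j S)" .
next
  fix j assume "j \<in> {1..m}"
  then show "(\<Sum>S\<in>Pow {1..n}. q_star n v \<sigma> x j S) = 1"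
    using bij by (intro sum_q_star_eq_1) blast
next
  fix j S assume j: "j \<in> {1..m}"
  have "0 \<le> x i j" if "i \<in> {1..n}" for i
  proof -
    have "0 \<le> y i i j" "y i i j \<le> x i j"
      using lp that j unfolding lp_feasible_def by blast+
    then show ?thesis
      by simp
  qed
  then show "0 \<le> q_star n v \<sigma> x j S"
    using v bij mono lp j by (intro q_star_nonneg) (auto simp: lp_feasible_def)
qed

lemma raoc_objective_q_star:
  assumes v: "\<forall>i\<in>{1..n}. \<forall>j\<in>{1..m}. v i j > 0"
    and bij: "\<forall>j\<in>{1..m}. bij_betw (\<sigma> j) {1..n} {1..n}"
  shows "raoc_objective n m r \<theta> v (q_star n v \<sigma> x) = lp_objective n m r \<theta> v x"
  unfolding raoc_objective_eq_lp lp_objective_def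
proof (intro sum.cong refl)
  fix i j assume j: "j \<in> {1..m}" and i: "i \<in> {1..n}"
  have "lp_x n v (q_star n v \<sigma> x) i j = x i j"
    using v bij i j by (intro lp_x_q_star) auto
  then show "\<theta> j * r i * v i j * lp_x n v (q_star n v \<sigma> x) i j = \<theta> j * r i * v i j * x i j"
    by simp
qed

theorem theorem18:
  fixes n m K :: nat
    and r :: "nat \<Rightarrow> real"
    and \<theta> :: "nat \<Rightarrow> real"
    and v :: "nat \<Rightarrow> nat \<Rightarrow> real"
    and C :: "nat \<Rightarrow> nat set"
    and L :: "nat \<Rightarrow> real"
    and x :: "nat \<Rightarrow> nat \<Rightarrow> real"
    and y :: "nat \<Rightarrow> nat \<Rightarrow> nat \<Rightarrow> real"
    and \<sigma> :: "nat \<Rightarrow> nat \<Rightarrow> nat"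
  assumes "\<forall>j\<in>{1..m}. \<theta> j \<ge> 0"
    and "(\<Sum>j=1..m. \<theta> j) = 1"
    and "\<forall>i\<in>{1..n}. \<forall>j\<in>{1..m}. v i j > 0"
    and "\<forall>k\<in>{1..K}. C k \<subseteq> {1..n}"
    and "\<forall>k\<in>{1..K}. 0 \<le> L k \<and> L k \<le> real (card (C k))"
    and "lp_optimal n m K r \<theta> v C L x y"
    and "\<forall>j\<in>{1..m}. bij_betw (\<sigma> j) {1..n} {1..n}"
    and "\<forall>j\<in>{1..m}. \<forall>l\<in>{1..<n}. x (\<sigma> j l) j \<ge> x (\<sigma> j (l + 1)) j"
  shows "raoc_optimal n m K r \<theta> v C L (q_star n v \<sigma> x)"
proof -
  have lp: "lp_feasible n m K \<theta> v C L x y"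
    using assms(6) by (simp add: lp_optimal_def)
  show ?thesis
    unfolding raoc_optimal_def
  proof (intro conjI allI impI)
    show "raoc_feasible n m K \<theta> C L (q_star n v \<sigma> x)"
      by (rule q_star_feasible[OF assms(1,3,4) lp assms(7,8)])
  next
    fix q' assume "raoc_feasible n m K \<theta> C L q'"
    then have "lp_feasible n m K \<theta> v C L (lp_x n v q') (lp_y n v q')"
      by (rule raoc_feasible_imp_lp_feasible[OF assms(3,4)])
    then have "lp_objective n m r \<theta> v (lp_x n v q') \<le> lp_objective n m r \<theta> v x"
      using assms(6) unfolding lp_optimal_def by blast
    then show "raoc_objective n m r \<theta> v q' \<le> raoc_objective n m r \<theta> v (q_star n v \<sigma> x)"
      by (simp only: raoc_objective_eq_lp[of n m r \<theta> v q'] raoc_objective_q_star[OF assms(3,7)])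
  qed
qed

end
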